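(* Let $\mu\in\mathbb{C}$ with $\mu\neq0,-1$, let $\sqrt{\mu}$ be a square root of $\mu$, and let $z=\sqrt{\mu}-1/\sqrt{\mu}$. If $$3\le\left|z\pm\sqrt{z^2+3}\right|$$ for at least one choice of the sign, then the specialised Burau representation $\tilde{\rho}_\mu:B_3\to\mathrm{GL}(2,\mathbb{C})$ is faithful.
   Context: $B_3=\langle\sigma_1,\sigma_2:\sigma_1\sigma_2\sigma_1=\sigma_2\sigma_1\sigma_2\rangle$ is the braid group on three strands. The reduced Burau representation is $\rho:B_3\to\mathrm{GL}(2,\mathbb{Z}[t^{\pm1}])$ given by $$\rho(\sigma_1)=\begin{pmatrix}-t&1\\0&1\end{pmatrix},\qquad\rho(\sigma_2)=\begin{pmatrix}1&0\\t&-t\end{pmatrix}.$$ For $\mu\in\mathbb{C}^*$, $\tilde{\rho}_\mu:B_3\to\mathrm{GL}(2,\mathbb{C})$ is the composition of $\rho$ with the substitution $t\mapsto\mu$. *)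

theory Defs
  imports "HOL-Analysis.Analysis" "HOL-Algebra.Group" "HOL-Library.Poly_Mapping"
begin

section \<open>The braid group on three strands\<close>

datatype braid_gen = Sigma1 | Sigma2

text \<open>
  A word in the generators and their formal inverses: \<open>(g, True)\<close> stands for the generator
  \<open>g\<close> and \<open>(g, False)\<close> for its inverse. The presented group is the set of words modulo the
  congruence generated by free cancellation and the braid relation.
\<close>

type_synonym braid_word = "(braid_gen \<times> bool) list"

inductive braid_step :: "braid_word \<Rightarrow> braid_word \<Rightarrow> bool" where
  cancel: "braid_step (u @ [(g, b), (g, \<not> b)] @ v) (u @ v)"
| braid: "braid_step (u @ [(Sigma1, True), (Sigma2, True), (Sigma1, True)] @ v)
                     (u @ [(Sigma2, True), (Sigma1, True), (Sigma2, True)] @ v)"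

lemma braid_step_context: "braid_step x y \<Longrightarrow> braid_step (p @ x @ q) (p @ y @ q)"
proof (induction rule: braid_step.induct)
  case (cancel u g b v)
  then show ?case using braid_step.cancel[of "p @ u" g b "v @ q"] by simp
next
  case (braid u v)
  then show ?case using braid_step.braid[of "p @ u" "v @ q"] by simp
qed

lemma braid_equiv_context:
  "equivclp braid_step x y \<Longrightarrow> equivclp braid_step (p @ x @ q) (p @ y @ q)"
proof (induction rule: equivclp_induct)
  case base
  then show ?case by simp
next
  case (step y z)
  then show ?case by (meson braid_step_context equivclp_into_equivclp)
qed

quotient_type braid3 = braid_word / "equivclp braid_step"
  by simp

lift_definition braid_mult :: "braid3 \<Rightarrow> braid3 \<Rightarrow> braid3" is "(@)"
proof -
  fix x x' y y' :: braid_word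
  assume "equivclp braid_step x x'" "equivclp braid_step y y'"
  then have "equivclp braid_step (x @ y) (x' @ y)" "equivclp braid_step (x' @ y) (x' @ y')"
    using braid_equiv_context[of x x' "[]" y] braid_equiv_context[of y y' x' "[]"] by simp_all
  then show "equivclp braid_step (x @ y) (x' @ y')"
    by (rule equivclp_trans)
qed

lift_definition braid_one :: braid3 is "[]" .

lift_definition sigma :: "braid_gen \<Rightarrow> braid3" is "\<lambda>g. [(g, True)]" .

definition B3 :: "braid3 monoid" where
  "B3 = \<lparr>carrier = UNIV, mult = braid_mult, one = braid_one\<rparr>"

lemma B3_simps [simp]:
  "carrier B3 = UNIV" "mult B3 = braid_mult" "one B3 = braid_one"
  by (simp_all add: B3_def)

definition word_inv :: "braid_word \<Rightarrow> braid_word" where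
  "word_inv w = rev (map (\<lambda>(g, b). (g, \<not> b)) w)"

lemma word_inv_left: "equivclp braid_step (word_inv w @ w) []"
proof (induction w)
  case Nil
  then show ?case by (simp add: word_inv_def)
next
  case (Cons a w)
  obtain g b where a: "a = (g, b)" by force
  have "braid_step (word_inv w @ [(g, \<not> b), (g, \<not> \<not> b)] @ w) (word_inv w @ w)"
    by (rule braid_step.cancel)
  then have "equivclp braid_step (word_inv (a # w) @ a # w) (word_inv w @ w)"
    by (simp add: word_inv_def a r_into_equivclp)
  then show ?case using Cons.IH by (rule equivclp_trans)
qed

lemma group_B3: "group B3"
proof (rule groupI)
  fix x y z :: braid3
  show "x \<otimes>\<^bsub>B3\<^esub> y \<otimes>\<^bsub>B3\<^esub> z = x \<otimes>\<^bsub>B3\<^esub> (y \<otimes>\<^bsub>B3\<^esub> z)"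
    unfolding B3_simps by transfer simp
  show "\<one>\<^bsub>B3\<^esub> \<otimes>\<^bsub>B3\<^esub> x = x"
    unfolding B3_simps by transfer simp
  have "\<exists>y. braid_mult y x = braid_one"
    by transfer (use word_inv_left in blast)
  then show "\<exists>y\<in>carrier B3. y \<otimes>\<^bsub>B3\<^esub> x = \<one>\<^bsub>B3\<^esub>" by simp
qed simp_all

subsection \<open>Evaluating words in a group\<close>

fun word_val :: "('a, 'm) monoid_scheme \<Rightarrow> (braid_gen \<Rightarrow> 'a) \<Rightarrow> braid_word \<Rightarrow> 'a" where
  "word_val G f [] = \<one>\<^bsub>G\<^esub>"
| "word_val G f ((g, b) # w) = (if b then f g else inv\<^bsub>G\<^esub> (f g)) \<otimes>\<^bsub>G\<^esub> word_val G f w"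

lemma word_val_closed:
  assumes "group G" "\<And>g. f g \<in> carrier G"
  shows "word_val G f w \<in> carrier G"
proof -
  interpret group G by fact
  show ?thesis by (induction w) (auto simp: assms)
qed

lemma word_val_append:
  assumes "group G" "\<And>g. f g \<in> carrier G"
  shows "word_val G f (u @ v) = word_val G f u \<otimes>\<^bsub>G\<^esub> word_val G f v"
proof -
  interpret group G by fact
  show ?thesis by (induction u) (auto simp: assms word_val_closed m_assoc)
qed

lemma word_val_braid_equiv:
  assumes G: "group G" and f: "\<And>g. f g \<in> carrier G"
    and rel: "f Sigma1 \<otimes>\<^bsub>G\<^esub> f Sigma2 \<otimes>\<^bsub>G\<^esub> f Sigma1 = f Sigma2 \<otimes>\<^bsub>G\<^esub> f Sigma1 \<otimes>\<^bsub>G\<^esub> f Sigma2"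
    and "equivclp braid_step x y"
  shows "word_val G f x = word_val G f y"
proof -
  interpret group G by fact
  have step: "word_val G f x = word_val G f y" if "braid_step x y" for x y
    using that
  proof cases
    case (cancel u g b v)
    have "word_val G f [(g, b), (g, \<not> b)] = \<one>\<^bsub>G\<^esub>"
      by (cases b) (simp_all add: f)
    then show ?thesis
      unfolding cancel by (simp only: word_val_append[OF G f] word_val_closed[OF G f] l_one)
  next
    case (braid u v)
    have "word_val G f [(Sigma1, True), (Sigma2, True), (Sigma1, True)] =
          word_val G f [(Sigma2, True), (Sigma1, True), (Sigma2, True)]"
      using rel by (simp add: f m_assoc)
    then show ?thesis
      unfolding braid by (simp only: word_val_append[OF G f])
  qed
  from assms(4) show ?thesis
    by (induction rule: equivclp_induct) (auto dest: step)
qed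

lemma B3_relation:
  "sigma Sigma1 \<otimes>\<^bsub>B3\<^esub> sigma Sigma2 \<otimes>\<^bsub>B3\<^esub> sigma Sigma1
   = sigma Sigma2 \<otimes>\<^bsub>B3\<^esub> sigma Sigma1 \<otimes>\<^bsub>B3\<^esub> sigma Sigma2"
  unfolding B3_simps
  by transfer (use braid_step.braid[of "[]" "[]"] in \<open>auto intro: r_into_equivclp\<close>)

section \<open>General linear groups\<close>

definition GL :: "('a::comm_ring_1 ^ 'n ^ 'n) monoid" where
  "GL = \<lparr>carrier = {A. invertible A}, mult = (**), one = mat 1\<rparr>"

lemma GL_simps [simp]:
  "carrier GL = {A. invertible A}" "mult GL = (**)" "one GL = mat 1"
  by (simp_all add: GL_def)

lemma group_GL: "group (GL :: ('a::comm_ring_1 ^ 'n ^ 'n) monoid)"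
proof (rule groupI)
  fix x y z :: "'a ^ 'n ^ 'n"
  assume x: "x \<in> carrier GL" and y: "y \<in> carrier GL"
  then obtain x' y' where x': "x ** x' = mat 1" "x' ** x = mat 1"
    and y': "y ** y' = mat 1" "y' ** y = mat 1"
    by (auto simp: invertible_def)
  have "(x ** y) ** (y' ** x') = mat 1"
    by (metis matrix_mul_assoc matrix_mul_rid x'(1) y'(1))
  moreover have "(y' ** x') ** (x ** y) = mat 1"
    by (metis matrix_mul_assoc matrix_mul_rid x'(2) y'(2))
  ultimately show "x \<otimes>\<^bsub>GL\<^esub> y \<in> carrier GL"
    by (auto simp: invertible_def)
  show "\<exists>y\<in>carrier GL. y \<otimes>\<^bsub>GL\<^esub> x = \<one>\<^bsub>GL\<^esub>"
    using x' by (auto simp: invertible_def)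
qed (auto simp: matrix_mul_assoc invertible_def)

section \<open>Laurent polynomials\<close>

text \<open>
  \<open>\<int>[t\<^sup>\<plusminus>\<^sup>1]\<close> as the group ring of the additive group of exponents: finitely supported
  functions from exponents to integer coefficients, with the convolution product.
\<close>

type_synonym laurent = "int \<Rightarrow>\<^sub>0 int"

definition laurent_t :: laurent where
  "laurent_t = Poly_Mapping.single 1 1"

definition laurent_eval :: "complex \<Rightarrow> laurent \<Rightarrow> complex" where
  "laurent_eval \<mu> p = (\<Sum>k\<in>Poly_Mapping.keys p. of_int (Poly_Mapping.lookup p k) * \<mu> powi k)"

lemma laurent_eval_0 [simp]: "laurent_eval \<mu> 0 = 0"
  by (simp add: laurent_eval_def)

lemma laurent_eval_single: "laurent_eval \<mu> (Poly_Mapping.single k c) = of_int c * \<mu> powi k"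
  by (simp add: laurent_eval_def)

lemma laurent_eval_1 [simp]: "laurent_eval \<mu> 1 = 1"
  using laurent_eval_single[of \<mu> 0 1] by simp

lemma laurent_eval_t [simp]: "laurent_eval \<mu> laurent_t = \<mu>"
  by (simp add: laurent_t_def laurent_eval_single)

lemma laurent_eval_add: "laurent_eval \<mu> (p + q) = laurent_eval \<mu> p + laurent_eval \<mu> q"
  unfolding laurent_eval_def
  by (rule setsum_keys_plus_distrib) (simp_all add: algebra_simps)

lemma laurent_eval_diff: "laurent_eval \<mu> (p - q) = laurent_eval \<mu> p - laurent_eval \<mu> q"
  using laurent_eval_add[of \<mu> "p - q" q] by simp

lemma laurent_eval_mult:
  assumes "\<mu> \<noteq> 0"
  shows "laurent_eval \<mu> (p * q) = laurent_eval \<mu> p * laurent_eval \<mu> q"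
proof -
  have "Poly_Mapping.keys p \<subseteq> UNIV" by simp
  then show ?thesis
  proof (induction p rule: frag_induction)
    case (one k)
    have "Poly_Mapping.keys q \<subseteq> UNIV" by simp
    then show ?case
    proof (induction q rule: frag_induction)
      case (one l)
      then show ?case
        using assms by (simp add: mult_single laurent_eval_single power_int_add)
    qed (simp_all add: laurent_eval_diff right_diff_distrib)
  qed (simp_all add: laurent_eval_diff left_diff_distrib)
qed

section \<open>The reduced Burau representation\<close>

fun burau_gen :: "braid_gen \<Rightarrow> laurent ^ 2 ^ 2" where
  "burau_gen Sigma1 = vector [vector [- laurent_t, 1], vector [0, 1]]"
| "burau_gen Sigma2 = vector [vector [1, 0], vector [laurent_t, - laurent_t]]"

lemma burau_gen_invertible: "invertible (burau_gen g)"
proof -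
  define s :: laurent where "s = Poly_Mapping.single (- 1) 1"
  have st [simp]: "s * laurent_t = 1" "laurent_t * s = 1"
    by (simp_all add: s_def laurent_t_def mult_single)
  have "burau_gen Sigma1 ** vector [vector [- s, s], vector [0, 1]] = mat 1"
    "vector [vector [- s, s], vector [0, 1]] ** burau_gen Sigma1 = mat 1"
    "burau_gen Sigma2 ** vector [vector [1, 0], vector [1, - s]] = mat 1"
    "vector [vector [1, 0], vector [1, - s]] ** burau_gen Sigma2 = mat 1"
    by (simp_all add: matrix_matrix_mult_def vec_eq_iff forall_2 sum_2 mat_def)
  then show ?thesis
    by (cases g) (auto simp only: invertible_def)
qed

lemma burau_gen_relation:
  "burau_gen Sigma1 ** burau_gen Sigma2 ** burau_gen Sigma1
   = burau_gen Sigma2 ** burau_gen Sigma1 ** burau_gen Sigma2"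
  by (simp add: matrix_matrix_mult_def vec_eq_iff forall_2 sum_2 algebra_simps)

lift_definition burau :: "braid3 \<Rightarrow> laurent ^ 2 ^ 2" is "word_val GL burau_gen"
  by (rule word_val_braid_equiv[OF group_GL])
     (simp_all add: burau_gen_invertible burau_gen_relation del: burau_gen.simps)

lemma burau_sigma: "burau (sigma g) = burau_gen g"
  by transfer simp

lemma burau_hom: "burau \<in> hom B3 GL"
proof (rule homI)
  fix x y
  show "burau x \<in> carrier GL"
    by transfer (rule word_val_closed[OF group_GL], simp add: burau_gen_invertible)
  show "burau (x \<otimes>\<^bsub>B3\<^esub> y) = burau x \<otimes>\<^bsub>GL\<^esub> burau y"
    unfolding B3_simps
    by transfer (rule word_val_append[OF group_GL], simp add: burau_gen_invertible)
qed

definition burau_at :: "complex \<Rightarrow> braid3 \<Rightarrow> complex ^ 2 ^ 2" where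
  "burau_at \<mu> x = map_matrix (laurent_eval \<mu>) (burau x)"

lemma burau_at_sigma:
  "burau_at \<mu> (sigma Sigma1) = vector [vector [- \<mu>, 1], vector [0, 1]]"
  "burau_at \<mu> (sigma Sigma2) = vector [vector [1, 0], vector [\<mu>, - \<mu>]]"
  using laurent_eval_diff[of \<mu> 0 laurent_t]
  by (simp_all add: burau_at_def burau_sigma vec_eq_iff forall_2)

lemma burau_at_hom:
  assumes "\<mu> \<noteq> 0"
  shows "burau_at \<mu> \<in> hom B3 GL"
proof -
  have mult: "map_matrix (laurent_eval \<mu>) (A ** B)
      = map_matrix (laurent_eval \<mu>) A ** map_matrix (laurent_eval \<mu>) B"
    for A B :: "laurent ^ 2 ^ 2"
    by (simp add: matrix_matrix_mult_def vec_eq_iff sum_2 laurent_eval_add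
        laurent_eval_mult[OF assms])
  have one: "map_matrix (laurent_eval \<mu>) (mat 1 :: laurent ^ 2 ^ 2) = mat 1"
    by (simp add: mat_def vec_eq_iff)
  show ?thesis
  proof (rule homI)
    fix x y
    have "invertible (burau x)"
      using burau_hom by (auto simp: hom_def Pi_iff)
    then show "burau_at \<mu> x \<in> carrier GL"
      unfolding burau_at_def invertible_def by (auto simp: invertible_def) (metis mult one)
    show "burau_at \<mu> (x \<otimes>\<^bsub>B3\<^esub> y) = burau_at \<mu> x \<otimes>\<^bsub>GL\<^esub> burau_at \<mu> y"
      using burau_hom mult by (simp add: hom_def burau_at_def)
  qed
qed

end

theory Submission
  imports Defs "HOL-Algebra.Generated_Groups"
begin

text \<open>
  The braid group is generated by \<open>b = \<sigma>\<^sub>1 \<sigma>\<^sub>2\<close> and \<open>a = \<sigma>\<^sub>1 \<sigma>\<^sub>2 \<sigma>\<^sub>1\<close>, which satisfy \<open>a\<^sup>2 = b\<^sup>3\<close>; this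
  element is central, and modulo it the group is the free product of a group of order 2 and one of
  order 3. The image of \<open>b\<close> acts on the projective line as a rotation of order 3 about two fixed
  points, and the image of \<open>a\<close> as an involution. The proof is a ping-pong argument: it finds a round
  disc that is disjoint from its two images under the rotation and whose boundary circle the
  involution preserves while exchanging its two sides.

  Put the fixed points of the rotation at \<open>0\<close> and \<open>\<infinity>\<close>. With \<open>y\<^sup>2 = z\<^sup>2 + 3\<close>, the involution is given, in
  suitably scaled coordinates, by the matrix with rows \<open>(z, -y)\<close> and \<open>(y, -z)\<close>
  (lemma \<open>burau_coordinates\<close>). An involution exchanges the sides of every circle through its two
  fixed points. Among these circles is one that is centred at some \<open>c > 1\<close> on the positive real axis
  and orthogonal to the unit circle, as soon as \<open>Re (z / y) > 0\<close>. It has radius \<open>sqrt (c\<^sup>2 - 1)\<close>, so it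
  stays in the sector of opening \<open>2 \<pi> / 3\<close> about the positive axis exactly if
  \<open>sqrt (c\<^sup>2 - 1) \<le> c sqrt 3 / 2\<close>, that is, if \<open>c \<le> 2\<close>. In terms of \<open>z\<close> and \<open>y\<close> these conditions hold
  when \<open>\<bar>z + y\<bar> \<ge> 3\<close> (lemma \<open>disc_parameter_exists\<close>); the two signs in the hypothesis are the two
  choices of \<open>y\<close>. The disc is handled as the negative cone of the Hermitian form \<open>disc_form\<close>, so that
  vectors replace points of the projective line.

  Ping-pong, started at a fixed point of the rotation, shows that an element of the kernel is a
  power of \<open>b\<close> (lemma \<open>ping_pong\<close>). The eigenvalues of the image of \<open>b\<close> have modulus \<open>\<bar>\<mu>\<bar>\<close>, which differs
  from 1 under the hypotheses (lemma \<open>norm_parameter_neq_1\<close>), so this power is trivial.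
\<close>

section \<open>Groups generated by a and b with a squared equal to b cubed\<close>

text \<open>
  Lifts of the reduced words of the free product that begin with \<open>a\<close>. The exponents of \<open>b\<close> range over
  all integers, not just over \<open>\<plusminus>1\<close>, so that powers of the central element \<open>b\<^sup>3\<close> are absorbed.
  Only the last exponent may be a multiple of 3.
\<close>

inductive_set (in group) alternating :: "'a \<Rightarrow> 'a \<Rightarrow> 'a set" for a b where
  last: "a \<otimes> b [^] (i::int) \<in> alternating a b"
| step: "\<not> 3 dvd i \<Longrightarrow> y \<in> alternating a b \<Longrightarrow> a \<otimes> (b [^] (i::int) \<otimes> y) \<in> alternating a b"

lemma (in group) alternating_closed:
  assumes "a \<in> carrier G" "b \<in> carrier G" "y \<in> alternating a b"
  shows "y \<in> carrier G"
  using assms(3) by induction (use assms in auto)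

definition (in group) normal_forms :: "'a \<Rightarrow> 'a \<Rightarrow> 'a set" where
  "normal_forms a b = range (\<lambda>j::int. b [^] j) \<union> {b [^] (j::int) \<otimes> y |j y. y \<in> alternating a b}"

lemma (in group) normal_forms_mult_power:
  assumes a: "a \<in> carrier G" and b: "b \<in> carrier G" and n: "n \<in> normal_forms a b"
  shows "b [^] (i::int) \<otimes> n \<in> normal_forms a b"
  using n unfolding normal_forms_def
proof (elim UnE rangeE CollectE exE conjE)
  fix j :: int assume "n = b [^] j"
  then have "b [^] i \<otimes> n = b [^] (i + j)" using b by (simp add: int_pow_mult)
  then show "b [^] i \<otimes> n \<in> range (\<lambda>j::int. b [^] j) \<union> {b [^] (j::int) \<otimes> y |j y. y \<in> alternating a b}"
    by blast
next
  fix j :: int and y assume *: "n = b [^] j \<otimes> y" "y \<in> alternating a b"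
  then have "b [^] i \<otimes> n = b [^] (i + j) \<otimes> y"
    using b alternating_closed[OF a b] by (simp add: int_pow_mult m_assoc)
  then show "b [^] i \<otimes> n \<in> range (\<lambda>j::int. b [^] j) \<union> {b [^] (j::int) \<otimes> y |j y. y \<in> alternating a b}"
    using * by blast
qed

text \<open>Every power of \<open>b\<^sup>3\<close> is a power of \<open>a\<close>.\<close>

lemma (in group) commute_central_power:
  assumes a: "a \<in> carrier G" and b: "b \<in> carrier G" and rel: "a \<otimes> a = b [^] (3::int)"
  shows "a \<otimes> b [^] (3 * k :: int) = b [^] (3 * k) \<otimes> a"
proof -
  have "a \<otimes> (a \<otimes> a) [^] k = (a \<otimes> a) [^] k \<otimes> a"
  proof -
    have "a \<otimes> a = a [^] (2::int)"
      using a int_pow_mult[of a 1 1] by simp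
    then have "a \<otimes> (a \<otimes> a) [^] k = a [^] (1 + 2 * k)" "(a \<otimes> a) [^] k \<otimes> a = a [^] (2 * k + 1)"
      using a by (simp_all add: int_pow_pow int_pow_mult)
    then show ?thesis by (simp add: add.commute)
  qed
  then show ?thesis using rel b by (simp add: int_pow_pow)
qed

lemma (in group) normal_forms_mult_left:
  assumes a: "a \<in> carrier G" and b: "b \<in> carrier G" and rel: "a \<otimes> a = b [^] (3::int)"
    and n: "n \<in> normal_forms a b"
  shows "a \<otimes> n \<in> normal_forms a b"
proof -
  have alt: "y \<in> normal_forms a b" if "y \<in> alternating a b" for y
  proof -
    have "b [^] (0::int) \<otimes> y = y" using alternating_closed[OF a b that] by simp
    then show ?thesis using that unfolding normal_forms_def by (metis (mono_tags, lifting) UnCI mem_Collect_eq)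
  qed
  from n consider j :: int where "n = b [^] j"
    | j :: int and y where "n = b [^] j \<otimes> y" "y \<in> alternating a b"
    unfolding normal_forms_def by blast
  then show ?thesis
  proof cases
    case 1
    then show ?thesis using alt alternating.last by simp
  next
    case 2
    note y = alternating_closed[OF a b 2(2)]
    show ?thesis
    proof (cases "3 dvd j")
      case False
      then show ?thesis using alt alternating.step 2 by simp
    next
      case True
      then obtain k where j: "j = 3 * k" by auto
      have move: "a \<otimes> n = b [^] j \<otimes> (a \<otimes> y)"
        using commute_central_power[OF a b rel, of k] a b y
        by (simp add: 2(1) j flip: m_assoc)
      \<comment> \<open>The leading \<open>a\<close> now meets the \<open>a\<close> with which \<open>y\<close> begins, and \<open>a\<^sup>2 = b\<^sup>3\<close>.\<close>
      have "a \<otimes> y \<in> normal_forms a b"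
        using 2(2)
      proof cases
        case (last i)
        have "a \<otimes> y = b [^] (3 + i)"
          using a b rel by (simp add: last int_pow_mult flip: m_assoc)
        then show ?thesis unfolding normal_forms_def by blast
      next
        case (step i y')
        have "a \<otimes> y = b [^] (3 + i) \<otimes> y'"
          using a b rel alternating_closed[OF a b step(3)]
          by (simp add: step int_pow_mult flip: m_assoc)
        then show ?thesis using step unfolding normal_forms_def by blast
      qed
      then show ?thesis unfolding move by (rule normal_forms_mult_power[OF a b])
    qed
  qed
qed

text \<open>
  The normal forms contain the identity and are stable under left multiplication by the generators
  and their inverses.\<close>

lemma (in group) generated_in_normal_forms:
  assumes a: "a \<in> carrier G" and b: "b \<in> carrier G" and rel: "a \<otimes> a = b [^] (3::int)"
    and x: "x \<in> generate G {a, b}"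
  shows "x \<in> normal_forms a b"
proof -
  have inv_a: "inv a = b [^] (-3::int) \<otimes> a"
    using a b rel by (intro inv_equality) (simp_all add: m_assoc int_pow_mult[symmetric])
  have closed: "n \<in> carrier G" if "n \<in> normal_forms a b" for n
    using that a b alternating_closed[OF a b] unfolding normal_forms_def by auto
  have b_power: "b [^] (1::int) = b" "b [^] (-1::int) = inv b"
    using b by (simp_all add: int_pow_neg)
  have mult: "x \<otimes> n \<in> normal_forms a b" if "n \<in> normal_forms a b" for n
    using x that
  proof (induction arbitrary: n)
    case one
    then show ?case using closed by simp
  next
    case (incl h)
    then show ?case
      using normal_forms_mult_left[OF a b rel] normal_forms_mult_power[OF a b, of n 1] b_power by auto
  next
    case (inv h)
    have "inv a \<otimes> n \<in> normal_forms a b"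
      using normal_forms_mult_power[OF a b normal_forms_mult_left[OF a b rel inv(2)], of "-3"]
        closed[OF inv(2)] a b by (simp add: inv_a m_assoc)
    then show ?case
      using inv normal_forms_mult_power[OF a b, of n "-1"] b_power by auto
  next
    case (eng h1 h2)
    have "h1 \<in> carrier G" "h2 \<in> carrier G"
      using eng(1,2) generate_in_carrier[of "{a, b}"] a b by auto
    then show ?case using eng closed by (simp add: m_assoc)
  qed
  have "\<one> = b [^] (0::int)" by simp
  then have "\<one> \<in> normal_forms a b"
    unfolding normal_forms_def by blast
  from mult[OF this] show ?thesis
    using generate_in_carrier[OF _ x] a b by auto
qed

text \<open>
  Reading an alternating word from the right, the base point \<open>p\<close> stays in \<open>P\<close> under the last power of
  \<open>b\<close>, then alternates between \<open>N\<close> and \<open>P\<close>, and ends in \<open>N\<close> because the leftmost letter is \<open>a\<close>. If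
  \<open>b\<^sup>j y\<close> acts trivially, then \<open>y\<close> acts as \<open>b\<^sup>-\<^sup>j\<close>, which keeps \<open>p\<close> in \<open>P\<close>; so \<open>y\<close> cannot be alternating.
\<close>

lemma (in group) ping_pong:
  fixes f :: "'a \<Rightarrow> 'v \<Rightarrow> 'v"
  assumes a: "a \<in> carrier G" and b: "b \<in> carrier G" and rel: "a \<otimes> a = b [^] (3::int)"
    and x: "x \<in> generate G {a, b}"
    and act: "\<And>x y v. x \<in> carrier G \<Longrightarrow> y \<in> carrier G \<Longrightarrow> f (x \<otimes> y) v = f x (f y v)"
    and disj: "P \<inter> N = {}"
    and aP: "\<And>v. v \<in> P \<Longrightarrow> f a v \<in> N"
    and bN: "\<And>i v. \<not> 3 dvd i \<Longrightarrow> v \<in> N \<Longrightarrow> f (b [^] (i::int)) v \<in> P"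
    and base: "\<And>i. f (b [^] (i::int)) p \<in> P"
    and triv: "\<And>v. f x v = v"
  shows "\<exists>j::int. x = b [^] j"
proof -
  have alt: "f y p \<in> N" if "y \<in> alternating a b" for y
    using that
  proof induction
    case (last i)
    then show ?case using act a b aP base by simp
  next
    case (step i y)
    then show ?case using act a b aP bN alternating_closed[OF a b step(2)] by simp
  qed
  have False if y: "y \<in> alternating a b" and xy: "x = b [^] j \<otimes> y" for j :: int and y
  proof -
    note yc = alternating_closed[OF a b y]
    have "y = b [^] (- j) \<otimes> x"
      using b yc by (simp add: xy int_pow_mult[symmetric] flip: m_assoc)
    then have "f y p = f (b [^] (- j)) p"
      using act triv b yc xy by (metis int_pow_closed m_closed)
    then show False using alt[OF y] base[of "- j"] disj by auto
  qed
  then show ?thesis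
    using generated_in_normal_forms[OF a b rel x] unfolding normal_forms_def by blast
qed

section \<open>Generators of the braid group\<close>

text \<open>The classes of one-letter words are the generators and their inverses.\<close>

lemma subgroup_B3_eq_UNIV:
  assumes H: "subgroup H B3" and gen: "\<And>g. sigma g \<in> H"
  shows "H = UNIV"
proof -
  interpret B3: group B3 by (rule group_B3)
  have "abs_braid3 w \<in> H" for w
  proof (induction w)
    case Nil
    have "abs_braid3 [] = \<one>\<^bsub>B3\<^esub>" by (simp add: braid_one_def)
    then show ?case using subgroup.one_closed[OF H] by metis
  next
    case (Cons l w)
    obtain g e where l: "l = (g, e)" by force
    have letter: "abs_braid3 [(g, e)] = (if e then sigma g else inv\<^bsub>B3\<^esub> sigma g)"
    proof (cases e)
      case False
      have "equivclp braid_step [(g, False), (g, True)] []"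
        using braid_step.cancel[of "[]" g False "[]"] by (auto intro: r_into_equivclp)
      then have "braid_mult (abs_braid3 [(g, False)]) (sigma g) = braid_one"
        by (simp add: sigma_def braid_one_def braid_mult.abs_eq braid3.abs_eq_iff)
      then have "inv\<^bsub>B3\<^esub> sigma g = abs_braid3 [(g, False)]"
        by (intro B3.inv_equality) simp_all
      then show ?thesis using False by simp
    qed (simp add: sigma_def)
    have "abs_braid3 (l # w) = abs_braid3 [(g, e)] \<otimes>\<^bsub>B3\<^esub> abs_braid3 w"
      by (simp add: l braid_mult.abs_eq)
    moreover have "abs_braid3 [(g, e)] \<in> H"
      using letter gen subgroup.m_inv_closed[OF H] by simp
    ultimately show ?case
      using Cons.IH subgroup.m_closed[OF H] by metis
  qed
  then show ?thesis using braid3.abs_induct[of "\<lambda>x. x \<in> H"] by blast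
qed

definition braid_b :: braid3 where
  "braid_b = sigma Sigma1 \<otimes>\<^bsub>B3\<^esub> sigma Sigma2"

definition braid_a :: braid3 where
  "braid_a = braid_b \<otimes>\<^bsub>B3\<^esub> sigma Sigma1"

lemma braid_a_square: "braid_a \<otimes>\<^bsub>B3\<^esub> braid_a = braid_b [^]\<^bsub>B3\<^esub> (3::int)"
proof -
  interpret B3: group B3 by (rule group_B3)
  have "braid_b [^]\<^bsub>B3\<^esub> (3::int) = braid_b \<otimes>\<^bsub>B3\<^esub> braid_b \<otimes>\<^bsub>B3\<^esub> braid_b"
    using int_pow_int[of B3 braid_b 3] by (simp add: numeral_3_eq_3 del: B3_simps(2))
  also have "\<dots> = (braid_b \<otimes>\<^bsub>B3\<^esub> sigma Sigma1) \<otimes>\<^bsub>B3\<^esub> (sigma Sigma2 \<otimes>\<^bsub>B3\<^esub> sigma Sigma1 \<otimes>\<^bsub>B3\<^esub> sigma Sigma2)"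
    by (simp add: braid_b_def B3.m_assoc del: B3_simps(2))
  also have "\<dots> = braid_a \<otimes>\<^bsub>B3\<^esub> braid_a"
    by (simp only: B3_relation[symmetric]) (simp add: braid_a_def braid_b_def del: B3_simps(2))
  finally show ?thesis by simp
qed

lemma generate_B3: "generate B3 {braid_a, braid_b} = UNIV"
proof (rule subgroup_B3_eq_UNIV)
  interpret B3: group B3 by (rule group_B3)
  show sub: "subgroup (generate B3 {braid_a, braid_b}) B3"
    by (rule B3.generate_is_subgroup) simp
  have mem: "braid_a \<in> generate B3 {braid_a, braid_b}" "braid_b \<in> generate B3 {braid_a, braid_b}"
    by (auto intro: generate.incl)
  have s1: "sigma Sigma1 = inv\<^bsub>B3\<^esub> braid_b \<otimes>\<^bsub>B3\<^esub> braid_a"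
    using B3.inv_solve_left[of "sigma Sigma1" braid_b braid_a] by (simp add: braid_a_def)
  have "braid_a = sigma Sigma2 \<otimes>\<^bsub>B3\<^esub> braid_b"
    using B3_relation by (simp add: braid_a_def braid_b_def B3.m_assoc del: B3_simps(2))
  then have s2: "sigma Sigma2 = braid_a \<otimes>\<^bsub>B3\<^esub> inv\<^bsub>B3\<^esub> braid_b"
    using B3.inv_solve_right[of "sigma Sigma2" braid_a braid_b] by simp
  fix g
  show "sigma g \<in> generate B3 {braid_a, braid_b}"
  proof (cases g)
    case Sigma1
    then show ?thesis using s1 mem subgroup.m_closed[OF sub] subgroup.m_inv_closed[OF sub] by metis
  next
    case Sigma2
    then show ?thesis using s2 mem subgroup.m_closed[OF sub] subgroup.m_inv_closed[OF sub] by metis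
  qed
qed

section \<open>A family of indefinite Hermitian forms\<close>

text \<open>
  For \<open>c > 1\<close>, the form is negative exactly when \<open>u / v\<close> lies in the open disc with centre \<open>c\<close> and
  radius \<open>sqrt (c\<^sup>2 - 1)\<close>.
\<close>

definition disc_form :: "real \<Rightarrow> complex \<Rightarrow> complex \<Rightarrow> real" where
  "disc_form c u v = (cmod u)\<^sup>2 + (cmod v)\<^sup>2 - 2 * c * Re (u * cnj v)"

lemma disc_form_scale: "disc_form c (k * u) (k * v) = (cmod k)\<^sup>2 * disc_form c u v"
proof -
  have "k * u * cnj (k * v) = of_real ((cmod k)\<^sup>2) * (u * cnj v)"
    unfolding complex_norm_square by (simp add: mult_ac)
  then have "Re (k * u * cnj (k * v)) = (cmod k)\<^sup>2 * Re (u * cnj v)"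
    by (simp only: Re_complex_of_real Im_complex_of_real times_complex.simps)
  then show ?thesis
    unfolding disc_form_def by (simp only: norm_mult power_mult_distrib) (simp add: algebra_simps)
qed

text \<open>
  For \<open>c \<le> 2\<close> the disc is disjoint from its rotations by the primitive cube roots of unity. Put
  \<open>n = \<bar>u\<bar>\<^sup>2 + \<bar>v\<bar>\<^sup>2\<close> and let \<open>p\<close> be the product of \<open>u\<close> and the conjugate of \<open>v\<close>, so that \<open>2 \<bar>p\<bar> \<le> n\<close>. If
  the form were not positive at the rotated vector, adding the two inequalities would give
  \<open>2 n < 2 c Re ((1 + \<zeta>) p) \<le> 2 c \<bar>p\<bar> \<le> 2 n\<close>, since \<open>\<bar>1 + \<zeta>\<bar> = \<bar>\<zeta>\<^sup>2\<bar> = 1\<close>.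
\<close>

lemma disc_form_rotate:
  assumes c: "0 \<le> c" "c \<le> 2" and neg: "disc_form c u v < 0" and \<zeta>: "\<zeta>\<^sup>2 + \<zeta> + 1 = 0"
  shows "0 < disc_form c (\<zeta> * u) v"
proof (rule ccontr)
  assume "\<not> 0 < disc_form c (\<zeta> * u) v"
  have "(\<zeta> - 1) * (\<zeta>\<^sup>2 + \<zeta> + 1) = \<zeta> ^ 3 - 1"
    by (simp add: algebra_simps power2_eq_square power3_eq_cube)
  then have "cmod \<zeta> ^ 3 = 1" using \<zeta> by (simp add: norm_power[symmetric])
  then have \<zeta>1: "cmod \<zeta> = 1" using power_eq_imp_eq_base[of "cmod \<zeta>" 3 1] by simp
  define n where "n = (cmod u)\<^sup>2 + (cmod v)\<^sup>2"
  define p where "p = u * cnj v"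
  have "n < 2 * c * Re p" "n \<le> 2 * c * Re (\<zeta> * p)"
    using neg \<open>\<not> _\<close> \<zeta>1 by (simp_all add: disc_form_def n_def p_def norm_mult mult.assoc)
  then have "2 * n < 2 * c * (Re p + Re (\<zeta> * p))"
    by (simp only: distrib_left)
  also have "Re p + Re (\<zeta> * p) = Re (- (\<zeta>\<^sup>2 * p))"
  proof -
    have "1 + \<zeta> = - \<zeta>\<^sup>2" using \<zeta> by (simp add: eq_neg_iff_add_eq_0 algebra_simps)
    then have "p + \<zeta> * p = - (\<zeta>\<^sup>2 * p)" by (metis distrib_right mult_1 mult_minus_left)
    then show ?thesis by (metis plus_complex.simps(1))
  qed
  also have "2 * c * Re (- (\<zeta>\<^sup>2 * p)) \<le> 2 * c * cmod p"
    using c complex_Re_le_cmod[of "- (\<zeta>\<^sup>2 * p)"] \<zeta>1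
    by (intro mult_left_mono) (simp_all add: norm_mult norm_power)
  also have "\<dots> \<le> c * n"
    using mult_left_mono[OF sum_squares_bound[of "cmod u" "cmod v"] c(1)]
    by (simp add: n_def p_def norm_mult mult_ac)
  also have "\<dots> \<le> 2 * n"
    using c(2) by (intro mult_right_mono) (simp_all add: n_def)
  finally show False by simp
qed

text \<open>
  For \<open>c > 1\<close>, the condition on \<open>c\<close> says that the boundary circle of the disc passes through the
  fixed points of the involution. The factor is negative when \<open>c > 1\<close> and \<open>Re (z * cnj y) > 0\<close>, and then the involution
  exchanges the inside and the outside of the disc.
\<close>

lemma disc_form_involution:
  assumes c: "((cmod z)\<^sup>2 + (cmod y)\<^sup>2) * c = Re (z * cnj y) * (1 + c\<^sup>2)" "c \<noteq> 0"
  shows "disc_form c (z * u - y * v) (y * u - z * v)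
       = - (Re (z * cnj y) * (c\<^sup>2 - 1) / c) * disc_form c u v"
proof -
  define T where "T = (cmod z)\<^sup>2 + (cmod y)\<^sup>2"
  define R where "R = Re (z * cnj y)"
  define n where "n = (cmod u)\<^sup>2 + (cmod v)\<^sup>2"
  define p where "p = Re (u * cnj v)"
  have e1: "(cmod (z * u - y * v))\<^sup>2 + (cmod (y * u - z * v))\<^sup>2 = T * n - 4 * R * p"
    unfolding T_def R_def n_def p_def cmod_power2
    by (simp add: algebra_simps power2_eq_square)
  have e2: "Re ((z * u - y * v) * cnj (y * u - z * v)) = R * n - T * p"
    unfolding T_def R_def n_def p_def cmod_power2
    by (simp add: algebra_simps power2_eq_square)
  have T: "T = R * (1 + c\<^sup>2) / c"
    using c by (simp add: T_def R_def field_simps)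
  show ?thesis
    unfolding disc_form_def e1 e2
    unfolding R_def[symmetric] n_def[symmetric] p_def[symmetric] T
    using c(2) by (simp add: field_simps power2_eq_square)
qed

lemma product_of_norms:
  assumes "y\<^sup>2 = z\<^sup>2 + 3"
  shows "(cmod (z + y))\<^sup>2 * (cmod (z - y))\<^sup>2 = 9"
proof -
  have "(z + y) * (z - y) = - 3"
    using assms by (simp add: algebra_simps power2_eq_square)
  then have "cmod (z + y) * cmod (z - y) = 3"
    by (metis norm_minus_cancel norm_mult norm_numeral)
  then have "(cmod (z + y) * cmod (z - y))\<^sup>2 = 9" by simp
  then show ?thesis by (simp add: power_mult_distrib)
qed

text \<open>
  With \<open>T = \<bar>z\<bar>\<^sup>2 + \<bar>y\<bar>\<^sup>2\<close> and \<open>R = Re (z * cnj y)\<close>, the equation for \<open>c\<close> is \<open>R (1 + c\<^sup>2) = T c\<close>, and it has a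
  root with \<open>1 < c \<le> 2\<close> when \<open>2 R < T \<le> 5 R / 2\<close>. The squared moduli \<open>A = T + 2 R\<close> of \<open>z + y\<close> and
  \<open>B = T - 2 R\<close> of \<open>z - y\<close> have product 9, so \<open>B > 0\<close>; and \<open>T \<le> 5 R / 2\<close> amounts to \<open>9 B \<le> A\<close>, that is,
  to \<open>A \<ge> 9\<close>.
\<close>

lemma disc_parameter_exists:
  assumes y: "y\<^sup>2 = z\<^sup>2 + 3" and large: "3 \<le> cmod (z + y)"
  obtains c where "1 < c" "c \<le> 2" "0 < Re (z * cnj y)"
    "((cmod z)\<^sup>2 + (cmod y)\<^sup>2) * c = Re (z * cnj y) * (1 + c\<^sup>2)"
proof -
  define T where "T = (cmod z)\<^sup>2 + (cmod y)\<^sup>2"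
  define R where "R = Re (z * cnj y)"
  define A where "A = (cmod (z + y))\<^sup>2"
  define B where "B = (cmod (z - y))\<^sup>2"
  have AB: "A * B = 9" using product_of_norms[OF y] by (simp add: A_def B_def)
  have A: "A = T + 2 * R" and B: "B = T - 2 * R"
    unfolding A_def B_def T_def R_def cmod_power2 by (simp_all add: algebra_simps power2_eq_square)
  have A9: "9 \<le> A" using power_mono[OF large, of 2] by (simp add: A_def)
  then have "9 * B \<le> A * B" by (intro mult_right_mono) (simp_all add: B_def)
  with AB have B1: "B \<le> 1" by simp
  have "B \<noteq> 0" using AB by auto
  then have B0: "0 < B" by (simp add: B_def)
  have R0: "0 < R" using A B A9 B1 by linarith
  define q where "q = (\<lambda>c. R * (1 + c\<^sup>2) - T * c)"
  have "q 1 \<le> 0" "0 \<le> q 2" using A B A9 B1 B0 by (simp_all add: q_def)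
  moreover have "\<forall>x. 1 \<le> x \<and> x \<le> 2 \<longrightarrow> isCont q x" by (simp add: q_def)
  ultimately obtain c where c: "1 \<le> c" "c \<le> 2" "q c = 0" using IVT[of q 1 0 2] by auto
  have "q 1 \<noteq> 0" using B B0 by (simp add: q_def)
  then have "1 < c" using c by (cases "c = 1") auto
  then show ?thesis using that[of c] c R0 by (simp add: q_def T_def R_def)
qed

text \<open>
  On the unit circle \<open>z\<close> is purely imaginary, \<open>z = \<i> \<sigma>\<close> with \<open>\<bar>\<sigma>\<bar> \<le> 2\<close>, and \<open>y\<^sup>2 = 3 - \<sigma>\<^sup>2\<close> is real. The
  squared moduli \<open>A\<close> and \<open>B\<close> of \<open>z + y\<close> and \<open>z - y\<close> have product 9, so \<open>A \<ge> 9\<close> forces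
  \<open>A + B \<ge> 10\<close>. As \<open>A + B = 2 (\<sigma>\<^sup>2 + \<bar>3 - \<sigma>\<^sup>2\<bar>) \<le> 10\<close> with equality only for \<open>\<sigma> = \<plusminus>2\<close>, the only point left
  is \<open>\<mu> = -1\<close>.
\<close>

lemma norm_parameter_neq_1:
  assumes "\<mu> \<noteq> - 1" and s: "s\<^sup>2 = \<mu>" and z: "z = s - 1 / s"
    and y: "y\<^sup>2 = z\<^sup>2 + 3" and large: "3 \<le> cmod (z + y)"
  shows "cmod \<mu> \<noteq> 1"
proof
  assume "cmod \<mu> = 1"
  then have "(cmod s)\<^sup>2 = 1" by (simp add: s[symmetric] norm_power)
  then have s1: "cmod s = 1" by (simp add: power2_eq_1_iff) (smt (verit) norm_ge_zero)
  define \<sigma> where "\<sigma> = 2 * Im s"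
  have "s * cnj s = 1" using s1 by (simp add: complex_norm_square[symmetric])
  then have "1 / s = cnj s" by (metis mult_zero_left nonzero_mult_div_cancel_left zero_neq_one)
  then have z\<sigma>: "z = \<i> * of_real \<sigma>" by (simp add: z \<sigma>_def complex_eq_iff)
  have \<sigma>2: "\<sigma>\<^sup>2 \<le> 4"
    using abs_Im_le_cmod[of s] s1 by (simp add: \<sigma>_def power_mult_distrib abs_square_le_1)
  have zz: "(cmod z)\<^sup>2 = \<sigma>\<^sup>2" by (simp add: z\<sigma> norm_mult)
  have "y\<^sup>2 = of_real (3 - \<sigma>\<^sup>2)" by (simp add: y z\<sigma> power_mult_distrib)
  then have yy: "(cmod y)\<^sup>2 = \<bar>3 - \<sigma>\<^sup>2\<bar>" by (metis norm_of_real norm_power)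
  define A where "A = (cmod (z + y))\<^sup>2"
  define B where "B = (cmod (z - y))\<^sup>2"
  have AB: "A * B = 9" using product_of_norms[OF y] by (simp add: A_def B_def)
  have sum: "A + B = 2 * (\<sigma>\<^sup>2 + \<bar>3 - \<sigma>\<^sup>2\<bar>)"
  proof -
    have "A + B = 2 * ((cmod z)\<^sup>2 + (cmod y)\<^sup>2)"
      unfolding A_def B_def cmod_power2 by (simp add: algebra_simps power2_eq_square)
    then show ?thesis by (simp only: zz yy)
  qed
  have A9: "9 \<le> A" using power_mono[OF large, of 2] by (simp add: A_def)
  then have "0 \<le> (A - 9) * (A - 1)" by simp
  then have "A * 10 \<le> A * (A + B)" using AB by (simp add: algebra_simps)
  then have "10 \<le> A + B" using A9 by simp
  then have "\<sigma>\<^sup>2 = 4" using sum \<sigma>2 by (cases "\<sigma>\<^sup>2 \<le> 3") auto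
  then have "(Im s)\<^sup>2 = 1" by (simp add: \<sigma>_def power_mult_distrib)
  moreover have "(Re s)\<^sup>2 = 0" using calculation s1 cmod_power2[of s] by simp
  ultimately have "s\<^sup>2 = - 1" by (simp add: complex_eq_iff power2_eq_square)
  then show False using assms(1) s by simp
qed

section \<open>Diagonal coordinates for the specialised Burau representation\<close>

lemma burau_at_mult:
  assumes "\<mu> \<noteq> 0"
  shows "burau_at \<mu> (x \<otimes>\<^bsub>B3\<^esub> y) = burau_at \<mu> x ** burau_at \<mu> y"
  using hom_mult[OF burau_at_hom[OF assms], of x y] by simp

lemma burau_at_one:
  assumes "\<mu> \<noteq> 0"
  shows "burau_at \<mu> \<one>\<^bsub>B3\<^esub> = mat 1"
  using hom_one[OF burau_at_hom[OF assms] group_B3 group_GL] by simp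

lemma burau_at_braid_b:
  assumes "\<mu> \<noteq> 0"
  shows "burau_at \<mu> braid_b *v v = vector [- \<mu> * v $ 2, \<mu> * v $ 1 - \<mu> * v $ 2]"
  unfolding braid_b_def burau_at_mult[OF assms] burau_at_sigma
  by (simp add: vec_eq_iff forall_2 matrix_matrix_mult_def matrix_vector_mult_def sum_2)

lemma burau_at_braid_a:
  assumes "\<mu> \<noteq> 0"
  shows "burau_at \<mu> braid_a *v v = vector [- \<mu> * v $ 2, - \<mu>\<^sup>2 * v $ 1]"
  unfolding braid_a_def burau_at_mult[OF assms] matrix_vector_mul_assoc[symmetric]
    burau_at_braid_b[OF assms] burau_at_sigma
  by (simp add: vec_eq_iff forall_2 matrix_vector_mult_def sum_2 algebra_simps power2_eq_square)

lemma eigenfunctional_power: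
  fixes \<phi> :: "complex ^ 2 \<Rightarrow> complex"
  assumes "\<mu> \<noteq> 0" and "\<nu> \<noteq> 0" and eigen: "\<And>v. \<phi> (burau_at \<mu> x *v v) = \<nu> * \<phi> v"
  shows "\<phi> (burau_at \<mu> (x [^]\<^bsub>B3\<^esub> (i::int)) *v v) = \<nu> powi i * \<phi> v"
proof (induction i arbitrary: v rule: int_induct[of _ 0])
  case base
  then show ?case using burau_at_one[OF assms(1)] by (simp del: B3_simps(3))
next
  interpret B3: group B3 by (rule group_B3)
  have step: "\<phi> (burau_at \<mu> (x [^]\<^bsub>B3\<^esub> (i + 1)) *v v) = \<nu> * \<phi> (burau_at \<mu> (x [^]\<^bsub>B3\<^esub> i) *v v)"
    for i :: int and v
  proof -
    have "x [^]\<^bsub>B3\<^esub> (i + 1) = x \<otimes>\<^bsub>B3\<^esub> x [^]\<^bsub>B3\<^esub> i"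
      using B3.int_pow_mult[of x 1 i] by (simp add: add.commute del: B3_simps(2))
    then show ?thesis
      by (simp only: burau_at_mult[OF assms(1)] matrix_vector_mul_assoc[symmetric] eigen)
  qed
  {
    case (step1 i)
    then show ?case using step[of i v] assms(2) by (simp add: power_int_add)
  next
    case (step2 i)
    then have "\<nu> powi i * \<phi> v = \<nu> * \<phi> (burau_at \<mu> (x [^]\<^bsub>B3\<^esub> (i - 1)) *v v)"
      using step[of "i - 1" v] by simp
    moreover have "\<nu> powi i = \<nu> * \<nu> powi (i - 1)"
      using assms(2) power_int_add[of \<nu> 1 "i - 1"] by simp
    ultimately show ?case using assms(2) by (simp add: mult.assoc)
  }
qed

lemma cube_root_power:
  fixes \<omega> :: complex
  assumes \<omega>: "\<omega>\<^sup>2 + \<omega> + 1 = 0" and i: "\<not> 3 dvd i"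
  shows "(\<omega> powi i)\<^sup>2 + \<omega> powi i + 1 = 0"
proof -
  have "(\<omega> - 1) * (\<omega>\<^sup>2 + \<omega> + 1) = \<omega> ^ 3 - 1"
    by (simp add: algebra_simps power2_eq_square power3_eq_cube)
  then have \<omega>3: "\<omega> ^ 3 = 1" using \<omega> by simp
  have \<omega>0: "\<omega> \<noteq> 0" using \<omega> by auto
  have "\<omega> powi i = \<omega> powi (3 * (i div 3) + i mod 3)" by simp
  also have "\<dots> = \<omega> powi (i mod 3)"
    using \<omega>0 \<omega>3 power_int_mult[of \<omega> 3 "i div 3"] by (subst power_int_add) simp_all
  finally have mod: "\<omega> powi i = \<omega> powi (i mod 3)" .
  have "i mod 3 = 1 \<or> i mod 3 = 2" using i by presburger
  then show ?thesis
  proof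
    assume "i mod 3 = 2"
    have "(\<omega>\<^sup>2)\<^sup>2 = \<omega> ^ 3 * \<omega>" by (simp add: power2_eq_square power3_eq_cube)
    then show ?thesis using mod \<omega> \<omega>3 \<open>i mod 3 = 2\<close> by (simp add: add.commute)
  qed (use mod \<omega> in simp)
qed

text \<open>
  The linear forms \<open>v\<^sub>1 + \<omega> v\<^sub>2\<close> and \<open>v\<^sub>1 + \<omega>\<^sup>2 v\<^sub>2\<close> are eigenvectors of the transpose of the image of \<open>b\<close>. In
  them, up to a common factor \<open>k\<close>, \<open>a\<close> has the diagonal entries \<open>z\<close> and \<open>-z\<close> and off-diagonal entries
  with product \<open>-y\<^sup>2\<close>, because \<open>\<mu> y\<^sup>2 = \<mu>\<^sup>2 + \<mu> + 1 = (\<mu> \<omega> - 1) (\<mu> \<omega>\<^sup>2 - 1)\<close>. The scalings of the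
  forms by \<open>y s\<close> and \<open>\<mu> \<omega>\<^sup>2 - 1\<close> turn the latter into \<open>-y\<close> and \<open>y\<close>. The vector \<open>p\<close> is a fixed point of
  the rotation and serves as the base point for ping-pong.
\<close>

lemma burau_coordinates:
  fixes \<mu> s z y :: complex
  assumes \<mu>: "\<mu> \<noteq> 0" and s: "s\<^sup>2 = \<mu>" and z: "z = s - 1 / s" and y: "y\<^sup>2 = z\<^sup>2 + 3" "y \<noteq> 0"
    and \<omega>: "\<omega>\<^sup>2 + \<omega> + 1 = 0"
  obtains \<alpha> \<beta> :: "complex ^ 2 \<Rightarrow> complex" and p k where
    "\<And>v. \<alpha> (burau_at \<mu> braid_b *v v) = \<mu> * \<omega> * \<alpha> v"
    "\<And>v. \<beta> (burau_at \<mu> braid_b *v v) = \<mu> * \<omega>\<^sup>2 * \<beta> v"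
    "\<And>v. \<alpha> (burau_at \<mu> braid_a *v v) = k * (z * \<alpha> v - y * \<beta> v)"
    "\<And>v. \<beta> (burau_at \<mu> braid_a *v v) = k * (y * \<alpha> v - z * \<beta> v)"
    "k \<noteq> 0" "\<alpha> p \<noteq> 0" "\<beta> p = 0"
proof -
  define \<alpha> :: "complex ^ 2 \<Rightarrow> complex" where "\<alpha> = (\<lambda>v. y * s * (v $ 1 + \<omega> * v $ 2))"
  define \<beta> :: "complex ^ 2 \<Rightarrow> complex" where "\<beta> = (\<lambda>v. (\<mu> * \<omega>\<^sup>2 - 1) * (v $ 1 + \<omega>\<^sup>2 * v $ 2))"
  define k where "k = \<mu> * s / (2 * \<omega> + 1)"
  have s0: "s \<noteq> 0" using \<mu> s by auto
  have \<omega>2: "\<omega>\<^sup>2 = - \<omega> - 1" using \<omega> by (simp add: eq_neg_iff_add_eq_0 algebra_simps)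
  have "(2 * \<omega> + 1)\<^sup>2 = - 3"
    using \<omega>2 by (simp add: power2_sum power_mult_distrib)
  then have d0: "2 * \<omega> + 1 \<noteq> 0" by auto
  have zs: "z * s = \<mu> - 1" using s0 by (simp add: z s[symmetric] field_simps power2_eq_square)
  have ys: "y\<^sup>2 * \<mu> = (\<mu> * \<omega>\<^sup>2 - 1) * (\<mu> * \<omega> - 1)"
  proof -
    have "y\<^sup>2 * \<mu> = (z * s)\<^sup>2 + 3 * \<mu>" by (simp add: y(1) s[symmetric] power_mult_distrib algebra_simps)
    also have "\<dots> = (\<mu> * \<omega>\<^sup>2 - 1) * (\<mu> * \<omega> - 1)"
      unfolding zs using \<omega>2 by algebra
    finally show ?thesis .
  qed
  show thesis
  proof (rule that[of \<alpha> \<beta> k "vector [1, - \<omega>]"])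
    fix v :: "complex ^ 2"
    show "\<alpha> (burau_at \<mu> braid_b *v v) = \<mu> * \<omega> * \<alpha> v"
      unfolding \<alpha>_def burau_at_braid_b[OF \<mu>] vector_2 using \<omega>2 by algebra
    show "\<beta> (burau_at \<mu> braid_b *v v) = \<mu> * \<omega>\<^sup>2 * \<beta> v"
      unfolding \<beta>_def burau_at_braid_b[OF \<mu>] vector_2 using \<omega>2 by algebra
    have "(2 * \<omega> + 1) * \<alpha> (burau_at \<mu> braid_a *v v) = \<mu> * s * (z * \<alpha> v - y * \<beta> v)"
      unfolding \<alpha>_def \<beta>_def burau_at_braid_a[OF \<mu>] vector_2 using \<omega>2 zs by algebra
    then show "\<alpha> (burau_at \<mu> braid_a *v v) = k * (z * \<alpha> v - y * \<beta> v)"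
      using d0 by (simp add: k_def field_simps)
    have "(2 * \<omega> + 1) * \<beta> (burau_at \<mu> braid_a *v v) = \<mu> * s * (y * \<alpha> v - z * \<beta> v)"
      unfolding \<alpha>_def \<beta>_def burau_at_braid_a[OF \<mu>] vector_2 using \<omega>2 zs ys s by algebra
    then show "\<beta> (burau_at \<mu> braid_a *v v) = k * (y * \<alpha> v - z * \<beta> v)"
      using d0 by (simp add: k_def field_simps)
  next
    show "k \<noteq> 0" using \<mu> s0 d0 by (simp add: k_def)
    have "\<alpha> (vector [1, - \<omega>]) = y * s * (2 + \<omega>)"
      unfolding \<alpha>_def vector_2 using \<omega>2 by algebra
    moreover have "2 + \<omega> \<noteq> 0"
    proof
      assume "2 + \<omega> = 0"
      then have "\<omega> = - 2" by (simp add: eq_neg_iff_add_eq_0 add.commute)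
      then show False using \<omega> by simp
    qed
    ultimately show "\<alpha> (vector [1, - \<omega>]) \<noteq> 0" using y(2) s0 by simp
    show "\<beta> (vector [1, - \<omega>]) = 0"
      unfolding \<beta>_def vector_2 using \<omega>2 by algebra
  qed
qed

theorem corollary6p5:
  fixes \<mu> s z :: complex
  assumes "\<mu> \<noteq> 0" and "\<mu> \<noteq> - 1"
    and "s\<^sup>2 = \<mu>"
    and "z = s - 1 / s"
    and "3 \<le> cmod (z + csqrt (z\<^sup>2 + 3)) \<or> 3 \<le> cmod (z - csqrt (z\<^sup>2 + 3))"
  shows "burau_at \<mu> \<in> mon B3 GL"
proof -
  interpret B3: group B3 by (rule group_B3)
  interpret group_hom B3 "GL :: (complex ^ 2 ^ 2) monoid" "burau_at \<mu>"
    using group_B3 group_GL burau_at_hom[OF assms(1)]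
    by (simp add: group_hom_def group_hom_axioms_def)
  obtain y where y: "y\<^sup>2 = z\<^sup>2 + 3" "3 \<le> cmod (z + y)"
  proof (cases "3 \<le> cmod (z + csqrt (z\<^sup>2 + 3))")
    case True
    then show thesis using that[of "csqrt (z\<^sup>2 + 3)"] by simp
  next
    case False
    then show thesis using that[of "- csqrt (z\<^sup>2 + 3)"] assms(5) by simp
  qed
  obtain c where c: "1 < c" "c \<le> 2" "0 < Re (z * cnj y)"
    "((cmod z)\<^sup>2 + (cmod y)\<^sup>2) * c = Re (z * cnj y) * (1 + c\<^sup>2)"
    using disc_parameter_exists[OF y] by blast
  then have "y \<noteq> 0" by auto
  define \<omega> where "\<omega> = Complex (- 1 / 2) (sqrt 3 / 2)"
  have \<omega>: "\<omega>\<^sup>2 + \<omega> + 1 = 0"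
    by (simp add: \<omega>_def complex_eq_iff power2_eq_square)
  have \<omega>0: "\<omega> \<noteq> 0" using \<omega> by auto
  have norm_\<omega>: "cmod \<omega> = 1"
    by (simp add: \<omega>_def cmod_def power_divide)
  obtain \<alpha> \<beta> :: "complex ^ 2 \<Rightarrow> complex" and p k where co:
    "\<And>v. \<alpha> (burau_at \<mu> braid_b *v v) = \<mu> * \<omega> * \<alpha> v"
    "\<And>v. \<beta> (burau_at \<mu> braid_b *v v) = \<mu> * \<omega>\<^sup>2 * \<beta> v"
    "\<And>v. \<alpha> (burau_at \<mu> braid_a *v v) = k * (z * \<alpha> v - y * \<beta> v)"
    "\<And>v. \<beta> (burau_at \<mu> braid_a *v v) = k * (y * \<alpha> v - z * \<beta> v)"
    "k \<noteq> 0" "\<alpha> p \<noteq> 0" "\<beta> p = 0"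
    using burau_coordinates[OF assms(1,3,4) y(1) \<open>y \<noteq> 0\<close> \<omega>] by metis
  have \<alpha>_power: "\<alpha> (burau_at \<mu> (braid_b [^]\<^bsub>B3\<^esub> i) *v v) = (\<mu> * \<omega>) powi i * \<alpha> v" for i :: int and v
    using eigenfunctional_power[of \<mu> "\<mu> * \<omega>" \<alpha>, OF assms(1) _ co(1)] assms(1) \<omega>0 by simp
  have \<beta>_power: "\<beta> (burau_at \<mu> (braid_b [^]\<^bsub>B3\<^esub> i) *v v) = (\<mu> * \<omega>\<^sup>2) powi i * \<beta> v" for i :: int and v
    using eigenfunctional_power[of \<mu> "\<mu> * \<omega>\<^sup>2" \<beta>, OF assms(1) _ co(2)] assms(1) \<omega>0 by simp
  define h where "h = (\<lambda>v. disc_form c (\<alpha> v) (\<beta> v))"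
  \<comment> \<open>On the projective line, \<open>h\<close> is negative inside the disc and positive outside its closure.\<close>
  have a_swaps: "h (burau_at \<mu> braid_a *v v) < 0" if "0 < h v" for v
  proof -
    have "h (burau_at \<mu> braid_a *v v)
        = - ((cmod k)\<^sup>2 * (Re (z * cnj y) * (c\<^sup>2 - 1) / c) * h v)"
      using c unfolding h_def co disc_form_scale by (subst disc_form_involution) simp_all
    moreover have "0 < Re (z * cnj y) * (c\<^sup>2 - 1) / c"
      using c by (intro divide_pos_pos mult_pos_pos) (simp_all add: one_less_power)
    then have "0 < (cmod k)\<^sup>2 * (Re (z * cnj y) * (c\<^sup>2 - 1) / c) * h v"
      using that co(5) by (intro mult_pos_pos) simp_all
    ultimately show ?thesis by linarith
  qed
  have b_rotates: "0 < h (burau_at \<mu> (braid_b [^]\<^bsub>B3\<^esub> i) *v v)"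
    if i: "\<not> 3 dvd i" and v: "h v < 0" for i :: int and v
  proof -
    \<comment> \<open>The ratio of the two eigenvalues of \<open>b\<^sup>i\<close>: a rotation of the coordinate \<open>\<alpha> / \<beta>\<close>.\<close>
    define \<zeta> where "\<zeta> = \<omega> powi (- i)"
    have "\<zeta>\<^sup>2 + \<zeta> + 1 = 0"
      unfolding \<zeta>_def using cube_root_power[OF \<omega>, of "- i"] i by simp
    then have "0 < disc_form c (\<zeta> * \<alpha> v) (\<beta> v)"
      using disc_form_rotate c v by (simp add: h_def)
    moreover have "(\<mu> * \<omega>) powi i = (\<mu> * \<omega>\<^sup>2) powi i * \<zeta>"
      using \<omega>0 by (simp add: \<zeta>_def power_int_mult_distrib power_int_minus power2_eq_square)
    ultimately show ?thesis
      using assms(1) \<omega>0 unfolding h_def \<alpha>_power \<beta>_power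
      by (simp add: disc_form_scale mult.assoc)
  qed
  have base: "0 < h (burau_at \<mu> (braid_b [^]\<^bsub>B3\<^esub> i) *v p)" for i :: int
    using co(6,7) assms(1) \<omega>0 by (simp add: h_def \<alpha>_power \<beta>_power disc_form_def)
  have "x = \<one>\<^bsub>B3\<^esub>" if kernel: "burau_at \<mu> x = mat 1" for x
  proof -
    have "\<exists>j::int. x = braid_b [^]\<^bsub>B3\<^esub> j"
    proof (rule B3.ping_pong[where f = "\<lambda>x v. burau_at \<mu> x *v v" and a = braid_a
          and P = "{v. 0 < h v}" and N = "{v. h v < 0}" and p = p])
      show "x \<in> generate B3 {braid_a, braid_b}" by (simp add: generate_B3)
    qed (use a_swaps b_rotates base kernel in
        \<open>auto simp: burau_at_mult[OF assms(1)] matrix_vector_mul_assoc braid_a_square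
          simp del: B3_simps(2)\<close>)
    then obtain j :: int where j: "x = braid_b [^]\<^bsub>B3\<^esub> j" by blast
    then have "(\<mu> * \<omega>) powi j = 1"
      using \<alpha>_power[of j p] kernel co(6) by simp
    then have "cmod \<mu> powi j = 1"
      using norm_\<omega> by (metis mult.right_neutral norm_mult norm_one norm_power_int)
    then have "j = 0"
      using norm_parameter_neq_1[OF assms(2-4) y] assms(1)
        powr_real_of_int'[of "cmod \<mu>" j] ln_powr[of "cmod \<mu>" "real_of_int j"] by auto
    then show ?thesis using j by simp
  qed
  then have "inj_on (burau_at \<mu>) (carrier B3)"
    by (subst inj_on_one_iff) auto
  then show ?thesis using burau_at_hom[OF assms(1)] by (simp add: mon_def)
qed

end
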